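(* Let $C$ be a compact tropical curve and let $f,g:C\to\mathbb{R}$ be finite-valued piecewise-linear functions with integer slopes. Then $$\sum_{x\in C} f(x)\,\operatorname{ord}_x(g)=\sum_{x\in C} g(x)\,\operatorname{ord}_x(f).$$
   Context: A compact tropical curve is understood as a compact metric graph with finitely many vertices and edges (edges ending at one-valent vertices are allowed to have infinite length, the point at infinity then being included). Piecewise-linear functions are continuous and have finitely many linear pieces with respect to the metric on the edges. For a piecewise-linear function $f$ with integer slopes on $C$ and a point $x\in C$, $\operatorname{ord}_x(f)=\sum_{e\ni x}\operatorname{slope}_e(f)$, where the sum is over all edge-germs (tangent directions) $e$ at $x$ and the slopes are taken in the outgoing directions from $x$. For such a function $\operatorname{ord}_x(f)=0$ for all but finitely many $x$, so both sums are finite; at a point at infinity of an infinite edge a finite-valued function is locally constant, so the order there is $0$. *)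

theory Defs
  imports "HOL-Analysis.Analysis"
begin

text \<open>
  A metric graph is given by a finite graph (loops and multiple edges are allowed) in which every
  edge \<open>e\<close> is identified with a closed interval \<open>[edge_lo e, edge_hi e]\<close> of the extended real line,
  \<open>edge_lo e\<close> being glued to the vertex \<open>tail e\<close> and \<open>edge_hi e\<close> to the vertex \<open>head e\<close>.
  The length of \<open>e\<close> is \<open>edge_hi e - edge_lo e\<close>; only this difference is of
  geometric significance.  An infinite endpoint of the interval is a point at infinity of the curve,
  and it is included as a vertex.  Using intervals instead of lengths also
  covers the edge \<open>[-\<infinity>, \<infinity>]\<close>, whose two ends are both at infinity.
\<close>

record ('v, 'e) metric_graph =
  verts :: "'v set"
  edges :: "'e set"
  tail :: "'e \<Rightarrow> 'v"
  head :: "'e \<Rightarrow> 'v"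
  edge_lo :: "'e \<Rightarrow> ereal"
  edge_hi :: "'e \<Rightarrow> ereal"

text \<open>A loop contributes 2 to the valence of its vertex.\<close>

definition valence :: "('v, 'e) metric_graph \<Rightarrow> 'v \<Rightarrow> nat" where
  "valence C v = card {e \<in> edges C. tail C e = v} + card {e \<in> edges C. head C e = v}"

definition compact_tropical_curve :: "('v, 'e) metric_graph \<Rightarrow> bool" where
  "compact_tropical_curve C \<longleftrightarrow>
     finite (verts C) \<and> finite (edges C) \<and>
     (\<forall>e\<in>edges C.
        tail C e \<in> verts C \<and> head C e \<in> verts C \<and> edge_lo C e < edge_hi C e \<and>
        (edge_lo C e = -\<infinity> \<longrightarrow> valence C (tail C e) = 1) \<and>
        (edge_hi C e = \<infinity> \<longrightarrow> valence C (head C e) = 1))"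

datatype ('v, 'e) point = Vertex 'v | Interior 'e real

definition points :: "('v, 'e) metric_graph \<Rightarrow> ('v, 'e) point set" where
  "points C = Vertex ` verts C \<union>
     {Interior e t | e t. e \<in> edges C \<and> edge_lo C e < ereal t \<and> ereal t < edge_hi C e}"

text \<open>The parametrization of the edge \<open>e\<close> by its interval; only arguments in
  \<open>{edge_lo C e..edge_hi C e}\<close> are meaningful.\<close>

definition edge_map :: "('v, 'e) metric_graph \<Rightarrow> 'e \<Rightarrow> ereal \<Rightarrow> ('v, 'e) point" where
  "edge_map C e t =
     (if t = edge_lo C e then Vertex (tail C e)
      else if t = edge_hi C e then Vertex (head C e)
      else Interior e (real_of_ereal t))"

text \<open>The topology is the quotient topology of the disjoint union of the edges and the vertices.\<close>

definition curve_topology :: "('v, 'e) metric_graph \<Rightarrow> ('v, 'e) point topology" where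
  "curve_topology C = topology (\<lambda>U. U \<subseteq> points C \<and>
     (\<forall>e\<in>edges C. openin (top_of_set {edge_lo C e..edge_hi C e})
        {t \<in> {edge_lo C e..edge_hi C e}. edge_map C e t \<in> U}))"

text \<open>
  Functions on the curve are functions on the type of points, of which only the values on
  \<open>points C\<close> matter; their codomain \<open>real\<close> makes them finite-valued also at infinity.
\<close>

definition piecewise_linear ::
    "('v, 'e) metric_graph \<Rightarrow> (('v, 'e) point \<Rightarrow> real) \<Rightarrow> bool" where
  "piecewise_linear C f \<longleftrightarrow>
     continuous_map (curve_topology C) euclideanreal f \<and>
     (\<forall>e\<in>edges C. \<exists>(n::nat) (\<tau> :: nat \<Rightarrow> ereal).
        \<tau> 0 = edge_lo C e \<and> \<tau> n = edge_hi C e \<and>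
        (\<forall>i<n. \<tau> i < \<tau> (Suc i) \<and>
           (\<exists>m c. \<forall>s. \<tau> i < s \<and> s < \<tau> (Suc i) \<longrightarrow>
              f (edge_map C e s) = m * real_of_ereal s + c)))"

text \<open>
  An edge-germ (tangent direction) is a triple \<open>(e, t, d)\<close>: the germ at the point with parameter
  \<open>t\<close> on the edge \<open>e\<close>, in the direction \<open>d\<close> of increasing or decreasing parameter.
  A loop contributes two germs at its vertex, one for each end.
\<close>

datatype direction = Increasing | Decreasing

definition germs :: "('v, 'e) metric_graph \<Rightarrow> ('v, 'e) point \<Rightarrow> ('e \<times> ereal \<times> direction) set" where
  "germs C x = {(e, t, d). e \<in> edges C \<and> t \<in> {edge_lo C e..edge_hi C e} \<and> edge_map C e t = x \<and>
     (case d of Increasing \<Rightarrow> t < edge_hi C e | Decreasing \<Rightarrow> edge_lo C e < t)}"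

text \<open>
  The slope along a germ, in the outgoing direction, is the slope of the affine function of the
  edge parameter with which \<open>f\<close> agrees near \<open>t\<close> on the side \<open>d\<close>.  This also makes sense for
  \<open>t = \<plusminus>\<infinity>\<close>, where finiteness and continuity of \<open>f\<close> force the slope to be 0.
\<close>

fun outgoing_slope ::
    "('v, 'e) metric_graph \<Rightarrow> (('v, 'e) point \<Rightarrow> real) \<Rightarrow> 'e \<times> ereal \<times> direction \<Rightarrow> real" where
  "outgoing_slope C f (e, t, Increasing) =
     (THE m. \<exists>c. \<forall>\<^sub>F s in at_right t. f (edge_map C e s) = m * real_of_ereal s + c)"
| "outgoing_slope C f (e, t, Decreasing) =
     (THE m. \<exists>c. \<forall>\<^sub>F s in at_left t. f (edge_map C e s) = (- m) * real_of_ereal s + c)"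

definition integer_slopes ::
    "('v, 'e) metric_graph \<Rightarrow> (('v, 'e) point \<Rightarrow> real) \<Rightarrow> bool" where
  "integer_slopes C f \<longleftrightarrow> (\<forall>x\<in>points C. \<forall>\<gamma>\<in>germs C x. outgoing_slope C f \<gamma> \<in> \<int>)"

definition ord_at ::
    "('v, 'e) metric_graph \<Rightarrow> (('v, 'e) point \<Rightarrow> real) \<Rightarrow> ('v, 'e) point \<Rightarrow> real" where
  "ord_at C f x = (\<Sum>\<gamma>\<in>germs C x. outgoing_slope C f \<gamma>)"

text \<open>
  The remaining lemmas show that the notions above are well defined: the topology axioms hold and
  the curve is compact, the slopes exist and are unique, and all sums involved are finite.
\<close>

lemma openin_curve_topology:
  "openin (curve_topology C) U \<longleftrightarrow> U \<subseteq> points C \<and>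
     (\<forall>e\<in>edges C. openin (top_of_set {edge_lo C e..edge_hi C e})
        {t \<in> {edge_lo C e..edge_hi C e}. edge_map C e t \<in> U})"
proof -
  let ?I = "\<lambda>e. {edge_lo C e..edge_hi C e}"
  let ?L = "\<lambda>U. U \<subseteq> points C \<and>
     (\<forall>e\<in>edges C. openin (top_of_set (?I e)) {t \<in> ?I e. edge_map C e t \<in> U})"
  have "?L (S \<inter> T)" if S: "?L S" and T: "?L T" for S T
  proof (intro conjI ballI)
    fix e assume e: "e \<in> edges C"
    have "{t \<in> ?I e. edge_map C e t \<in> S \<inter> T} =
        {t \<in> ?I e. edge_map C e t \<in> S} \<inter> {t \<in> ?I e. edge_map C e t \<in> T}" by blast
    moreover have "openin (top_of_set (?I e)) {t \<in> ?I e. edge_map C e t \<in> S}"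
        "openin (top_of_set (?I e)) {t \<in> ?I e. edge_map C e t \<in> T}"
      using S T e by blast+
    ultimately show "openin (top_of_set (?I e)) {t \<in> ?I e. edge_map C e t \<in> S \<inter> T}"
      by (simp only: openin_Int)
  qed (use S in blast)
  moreover have "?L (\<Union>K)" if K: "\<forall>S\<in>K. ?L S" for K
  proof (intro conjI ballI)
    fix e assume e: "e \<in> edges C"
    have "{t \<in> ?I e. edge_map C e t \<in> \<Union>K} = (\<Union>S\<in>K. {t \<in> ?I e. edge_map C e t \<in> S})"
      by blast
    moreover have "openin (top_of_set (?I e)) (\<Union>S\<in>K. {t \<in> ?I e. edge_map C e t \<in> S})"
      by (rule openin_Union) (use K e in blast)
    ultimately show "openin (top_of_set (?I e)) {t \<in> ?I e. edge_map C e t \<in> \<Union>K}"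
      by (simp only:)
  qed (use K in blast)
  ultimately have "istopology ?L"
    unfolding istopology_def by blast
  then show ?thesis
    unfolding curve_topology_def by (simp add: topology_inverse')
qed

lemma edge_map_in_points:
  assumes "compact_tropical_curve C" "e \<in> edges C" "t \<in> {edge_lo C e..edge_hi C e}"
  shows "edge_map C e t \<in> points C"
proof (cases "t = edge_lo C e \<or> t = edge_hi C e")
  case True
  then show ?thesis
    using assms by (auto simp: edge_map_def points_def compact_tropical_curve_def)
next
  case False
  then have "edge_lo C e < t" "t < edge_hi C e" using assms(3) by auto
  moreover from this have "ereal (real_of_ereal t) = t"
    by (cases t) auto
  ultimately show ?thesis
    using assms by (auto simp: edge_map_def points_def)
qed

lemma topspace_curve_topology:
  assumes "compact_tropical_curve C"
  shows "topspace (curve_topology C) = points C"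
proof -
  have "openin (curve_topology C) (points C)"
    unfolding openin_curve_topology
  proof (intro conjI ballI)
    fix e assume "e \<in> edges C"
    then have "{t \<in> {edge_lo C e..edge_hi C e}. edge_map C e t \<in> points C} =
        {edge_lo C e..edge_hi C e}"
      using edge_map_in_points[OF assms] by blast
    then show "openin (top_of_set {edge_lo C e..edge_hi C e})
        {t \<in> {edge_lo C e..edge_hi C e}. edge_map C e t \<in> points C}"
      by simp
  qed simp
  then have "points C \<subseteq> topspace (curve_topology C)"
    by (rule openin_subset)
  moreover have "topspace (curve_topology C) \<subseteq> points C"
    using openin_topspace[of "curve_topology C"] unfolding openin_curve_topology by (rule conjunct1)
  ultimately show ?thesis by (rule subset_antisym[rotated])
qed

lemma continuous_map_edge_map:
  assumes "compact_tropical_curve C" "e \<in> edges C"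
  shows "continuous_map (top_of_set {edge_lo C e..edge_hi C e}) (curve_topology C) (edge_map C e)"
  using assms edge_map_in_points[OF assms]
  unfolding continuous_map_def topspace_curve_topology[OF assms(1)]
  by (auto simp: openin_curve_topology)

lemma compact_space_curve_topology:
  assumes C: "compact_tropical_curve C"
  shows "compact_space (curve_topology C)"
proof -
  let ?I = "\<lambda>e. {edge_lo C e..edge_hi C e}"
  have fin: "finite (verts C)" "finite (edges C)"
    using C by (auto simp: compact_tropical_curve_def)
  have "points C = Vertex ` verts C \<union> (\<Union>e\<in>edges C. edge_map C e ` ?I e)"
  proof (intro subset_antisym subsetI)
    fix x assume "x \<in> points C"
    then consider "x \<in> Vertex ` verts C"
      | e t where "x = Interior e t" "e \<in> edges C" "edge_lo C e < ereal t" "ereal t < edge_hi C e"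
      by (auto simp: points_def)
    then show "x \<in> Vertex ` verts C \<union> (\<Union>e\<in>edges C. edge_map C e ` ?I e)"
    proof cases
      case 2
      then have "x = edge_map C e (ereal t)" "ereal t \<in> ?I e" by (auto simp: edge_map_def)
      then show ?thesis using 2(2) by blast
    qed simp
  next
    fix x assume "x \<in> Vertex ` verts C \<union> (\<Union>e\<in>edges C. edge_map C e ` ?I e)"
    moreover have "Vertex ` verts C \<subseteq> points C" by (auto simp: points_def)
    ultimately show "x \<in> points C" using edge_map_in_points[OF C] by blast
  qed
  moreover have "compactin (curve_topology C) (Vertex ` verts C)"
    using fin by (intro finite_imp_compactin) (auto simp: topspace_curve_topology[OF C] points_def)
  moreover have "compactin (curve_topology C) (\<Union>e\<in>edges C. edge_map C e ` ?I e)"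
  proof (intro compactin_Union)
    fix S assume "S \<in> (\<lambda>e. edge_map C e ` ?I e) ` edges C"
    then obtain e where e: "e \<in> edges C" "S = edge_map C e ` ?I e" by blast
    have "compactin (top_of_set (?I e)) (?I e)"
      by (simp add: compactin_subtopology compact_eq_closed)
    then show "compactin (curve_topology C) S"
      unfolding e(2) by (rule image_compactin) (rule continuous_map_edge_map[OF C e(1)])
  qed (use fin in simp)
  ultimately show ?thesis
    by (simp add: compact_space_def topspace_curve_topology[OF C] compactin_Un)
qed

lemma finite_germs:
  assumes "compact_tropical_curve C"
  shows "finite (germs C x)"
proof -
  have "germs C x \<subseteq>
      (\<Union>e\<in>edges C. {e} \<times> {edge_lo C e, edge_hi C e, (case x of Vertex v \<Rightarrow> 0 | Interior _ t \<Rightarrow> ereal t)}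
        \<times> {Increasing, Decreasing})"
  proof clarify
    fix e t d assume "(e, t, d) \<in> germs C x"
    then have *: "e \<in> edges C" "t \<in> {edge_lo C e..edge_hi C e}" "edge_map C e t = x"
      by (auto simp: germs_def)
    have "t \<in> {edge_lo C e, edge_hi C e, (case x of Vertex v \<Rightarrow> 0 | Interior _ t \<Rightarrow> ereal t)}"
    proof (rule ccontr)
      assume n: "\<not> ?thesis"
      then have "edge_lo C e < t" "t < edge_hi C e" using *(2) by auto
      then have "ereal (real_of_ereal t) = t" by (cases t) auto
      moreover have "x = Interior e (real_of_ereal t)" using n *(3) by (auto simp: edge_map_def)
      ultimately show False using n by simp
    qed
    then show "(e, t, d) \<in> (\<Union>e\<in>edges C. {e} \<times>
        {edge_lo C e, edge_hi C e, (case x of Vertex v \<Rightarrow> 0 | Interior _ t \<Rightarrow> ereal t)}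
        \<times> {Increasing, Decreasing})"
      using *(1) by (cases d) auto
  qed
  then show ?thesis
    by (rule finite_subset) (use assms in \<open>auto simp: compact_tropical_curve_def\<close>)
qed

lemma affine_slope_unique:
  fixes a b :: ereal and m c m' c' :: real
  assumes "a < b"
    and eq: "\<And>s. a < s \<Longrightarrow> s < b \<Longrightarrow> m * real_of_ereal s + c = m' * real_of_ereal s + c'"
  shows "m = m'"
proof -
  obtain p where p: "a < ereal p" "ereal p < b" using ereal_dense2[OF assms(1)] by blast
  obtain q where q: "ereal p < ereal q" "ereal q < b" using ereal_dense2[OF p(2)] by blast
  have 1: "m * p + c = m' * p + c'" using eq[of "ereal p"] p by simp
  have "a < ereal q" using p(1) q(1) by (rule less_trans)
  then have 2: "m * q + c = m' * q + c'" using eq[of "ereal q"] q by simp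
  have "(m - m') * (q - p) = 0" using 1 2 by (simp add: algebra_simps)
  then show ?thesis using q by simp
qed

lemma outgoing_slope_IncreasingI:
  assumes "t < \<infinity>" and m: "\<forall>\<^sub>F s in at_right t. f (edge_map C e s) = m * real_of_ereal s + c"
  shows "outgoing_slope C f (e, t, Increasing) = m"
  unfolding outgoing_slope.simps
proof (rule the_equality)
  fix m' assume "\<exists>c. \<forall>\<^sub>F s in at_right t. f (edge_map C e s) = m' * real_of_ereal s + c"
  then obtain c' where "\<forall>\<^sub>F s in at_right t. f (edge_map C e s) = m' * real_of_ereal s + c'" ..
  with m have "\<forall>\<^sub>F s in at_right t. m' * real_of_ereal s + c' = m * real_of_ereal s + c"
    by eventually_elim simp
  then obtain b where "t < b"
      "\<And>s. t < s \<Longrightarrow> s < b \<Longrightarrow> m' * real_of_ereal s + c' = m * real_of_ereal s + c"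
    unfolding eventually_at_right[OF assms(1)] by blast
  then show "m' = m" by (rule affine_slope_unique)
qed (use m in blast)

lemma outgoing_slope_DecreasingI:
  assumes "- \<infinity> < t" and m: "\<forall>\<^sub>F s in at_left t. f (edge_map C e s) = (- m) * real_of_ereal s + c"
  shows "outgoing_slope C f (e, t, Decreasing) = m"
  unfolding outgoing_slope.simps
proof (rule the_equality)
  fix m' assume "\<exists>c. \<forall>\<^sub>F s in at_left t. f (edge_map C e s) = (- m') * real_of_ereal s + c"
  then obtain c' where "\<forall>\<^sub>F s in at_left t. f (edge_map C e s) = (- m') * real_of_ereal s + c'" ..
  with m have "\<forall>\<^sub>F s in at_left t. (- m') * real_of_ereal s + c' = (- m) * real_of_ereal s + c"
    by eventually_elim simp
  then obtain b where "b < t"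
      "\<And>s. b < s \<Longrightarrow> s < t \<Longrightarrow> (- m') * real_of_ereal s + c' = (- m) * real_of_ereal s + c"
    unfolding eventually_at_left[OF assms(1)] by blast
  then have "- m' = - m" by (rule affine_slope_unique)
  then show "m' = m" by simp
qed (use m in blast)

lemma exists_breakpoint_gap:
  fixes \<tau> :: "nat \<Rightarrow> 'a::linorder"
  assumes "\<tau> 0 \<le> t" "t < \<tau> n"
  shows "\<exists>i<n. \<tau> i \<le> t \<and> t < \<tau> (Suc i)"
  using assms
proof (induction n)
  case (Suc n)
  then show ?case by (cases "t < \<tau> n") (auto intro: less_SucI simp: not_less)
qed simp

lemma exists_breakpoint_gap':
  fixes \<tau> :: "nat \<Rightarrow> 'a::linorder"
  assumes "\<tau> 0 < t" "t \<le> \<tau> n"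
  shows "\<exists>i<n. \<tau> i < t \<and> t \<le> \<tau> (Suc i)"
  using assms
proof (induction n)
  case (Suc n)
  then show ?case by (cases "t \<le> \<tau> n") (auto intro: less_SucI simp: not_le)
qed simp

lemma piecewise_linearE:
  assumes "piecewise_linear C f" "e \<in> edges C"
  obtains n \<tau> where "\<tau> (0::nat) = edge_lo C e" "\<tau> n = edge_hi C e"
      "\<forall>i<n. \<exists>m c. \<forall>s. \<tau> i < s \<and> s < \<tau> (Suc i) \<longrightarrow>
              f (edge_map C e s) = m * real_of_ereal s + c"
  using assms unfolding piecewise_linear_def by blast

lemma outgoing_slope_exists:
  assumes pl: "piecewise_linear C f" and germ: "(e, t, d) \<in> germs C x"
  shows "case d of
      Increasing \<Rightarrow> \<exists>c. \<forall>\<^sub>F s in at_right t.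
        f (edge_map C e s) = outgoing_slope C f (e, t, d) * real_of_ereal s + c
    | Decreasing \<Rightarrow> \<exists>c. \<forall>\<^sub>F s in at_left t.
        f (edge_map C e s) = (- outgoing_slope C f (e, t, d)) * real_of_ereal s + c"
proof -
  have e: "e \<in> edges C" and t: "edge_lo C e \<le> t" "t \<le> edge_hi C e"
    using germ by (auto simp: germs_def)
  obtain n \<tau> where \<tau>: "\<tau> (0::nat) = edge_lo C e" "\<tau> n = edge_hi C e"
        "\<forall>i<n. \<exists>m c. \<forall>s. \<tau> i < s \<and> s < \<tau> (Suc i) \<longrightarrow>
                f (edge_map C e s) = m * real_of_ereal s + c"
    by (rule piecewise_linearE[OF pl e])
  show ?thesis
  proof (cases d)
    case Increasing
    then have "t < edge_hi C e" using germ by (auto simp: germs_def)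
    then obtain i where i: "i < n" "\<tau> i \<le> t" "t < \<tau> (Suc i)"
      using exists_breakpoint_gap[of \<tau> t n] t \<tau>(1,2) by auto
    obtain m c where m: "\<And>s. \<tau> i < s \<Longrightarrow> s < \<tau> (Suc i) \<Longrightarrow>
              f (edge_map C e s) = m * real_of_ereal s + c" using \<tau>(3) i(1) by blast
    have ev: "\<forall>\<^sub>F s in at_right t. f (edge_map C e s) = m * real_of_ereal s + c"
      unfolding eventually_at_right[OF i(3)] using i m by (intro exI[of _ "\<tau> (Suc i)"]) auto
    have "t < \<infinity>" using i(3) by (cases t) auto
    from outgoing_slope_IncreasingI[OF this ev] ev show ?thesis using Increasing by auto
  next
    case Decreasing
    then have "edge_lo C e < t" using germ by (auto simp: germs_def)
    then obtain i where i: "i < n" "\<tau> i < t" "t \<le> \<tau> (Suc i)"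
      using exists_breakpoint_gap'[of \<tau> t n] t \<tau>(1,2) by auto
    obtain m c where m: "\<And>s. \<tau> i < s \<Longrightarrow> s < \<tau> (Suc i) \<Longrightarrow>
              f (edge_map C e s) = m * real_of_ereal s + c" using \<tau>(3) i(1) by blast
    have ev: "\<forall>\<^sub>F s in at_left t. f (edge_map C e s) = (- (- m)) * real_of_ereal s + c"
      unfolding eventually_at_left[OF i(2)] using i m by (intro exI[of _ "\<tau> i"]) auto
    have "- \<infinity> < t" using i(2) by (cases t) auto
    from outgoing_slope_DecreasingI[OF this ev] ev show ?thesis using Decreasing by auto
  qed
qed

lemma finite_ord_support:
  assumes C: "compact_tropical_curve C" and pl: "piecewise_linear C f"
  shows "finite {x \<in> points C. ord_at C f x \<noteq> 0}"
proof -
  have "\<forall>e\<in>edges C. \<exists>B. finite B \<and> (\<forall>t. edge_lo C e < ereal t \<and> ereal t < edge_hi C e \<and>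
      ord_at C f (Interior e t) \<noteq> 0 \<longrightarrow> ereal t \<in> B)"
  proof
    fix e assume e: "e \<in> edges C"
    obtain n \<tau> where \<tau>: "\<tau> (0::nat) = edge_lo C e" "\<tau> n = edge_hi C e"
        "\<forall>i<n. \<exists>m c. \<forall>s. \<tau> i < s \<and> s < \<tau> (Suc i) \<longrightarrow>
                f (edge_map C e s) = m * real_of_ereal s + c"
      by (rule piecewise_linearE[OF pl e])
    have "ereal t \<in> \<tau> ` {..n}"
      if t: "edge_lo C e < ereal t" "ereal t < edge_hi C e" "ord_at C f (Interior e t) \<noteq> 0" for t
    proof (rule ccontr)
      assume nt: "ereal t \<notin> \<tau> ` {..n}"
      obtain i where i: "i < n" "\<tau> i \<le> ereal t" "ereal t < \<tau> (Suc i)"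
        using exists_breakpoint_gap[of \<tau> "ereal t" n] t \<tau>(1,2) by (auto simp: less_imp_le)
      have i': "\<tau> i < ereal t" using nt i by (metis atMost_iff image_eqI less_imp_le order_le_less)
      obtain m c where m: "\<And>s. \<tau> i < s \<Longrightarrow> s < \<tau> (Suc i) \<Longrightarrow>
              f (edge_map C e s) = m * real_of_ereal s + c" using \<tau>(3) i(1) by blast
      have "\<forall>\<^sub>F s in at_right (ereal t). f (edge_map C e s) = m * real_of_ereal s + c"
        unfolding eventually_at_right[OF i(3)] using i i' m by (intro exI[of _ "\<tau> (Suc i)"]) auto
      then have 1: "outgoing_slope C f (e, ereal t, Increasing) = m"
        by (intro outgoing_slope_IncreasingI) auto
      have "\<forall>\<^sub>F s in at_left (ereal t). f (edge_map C e s) = (- (- m)) * real_of_ereal s + c"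
        unfolding eventually_at_left[OF i'] using i i' m by (intro exI[of _ "\<tau> i"]) auto
      then have 2: "outgoing_slope C f (e, ereal t, Decreasing) = - m"
        by (intro outgoing_slope_DecreasingI) auto
      have "germs C (Interior e t) = {(e, ereal t, Increasing), (e, ereal t, Decreasing)}"
      proof (intro subset_antisym subsetI)
        fix g assume "g \<in> germs C (Interior e t)"
        then obtain e' s d where g: "g = (e', s, d)" "s \<in> {edge_lo C e'..edge_hi C e'}"
            "edge_map C e' s = Interior e t"
          by (auto simp: germs_def)
        then have s: "s \<noteq> edge_lo C e'" "s \<noteq> edge_hi C e'" "e' = e" "real_of_ereal s = t"
          by (auto simp: edge_map_def split: if_splits)
        then have "edge_lo C e' < s" "s < edge_hi C e'" using g(2) by auto
        then have "s = ereal t" using s by (cases s) auto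
        then show "g \<in> {(e, ereal t, Increasing), (e, ereal t, Decreasing)}"
          using g s by (cases d) auto
      qed (use e t in \<open>auto simp: germs_def edge_map_def\<close>)
      then have "ord_at C f (Interior e t) = 0" using 1 2 by (simp add: ord_at_def)
      then show False using t(3) by simp
    qed
    then show "\<exists>B. finite B \<and> (\<forall>t. edge_lo C e < ereal t \<and> ereal t < edge_hi C e \<and>
        ord_at C f (Interior e t) \<noteq> 0 \<longrightarrow> ereal t \<in> B)"
      by (intro exI[of _ "\<tau> ` {..n}"]) auto
  qed
  then obtain B where B: "\<And>e. e \<in> edges C \<Longrightarrow> finite (B e)"
      "\<And>e t. e \<in> edges C \<Longrightarrow> edge_lo C e < ereal t \<Longrightarrow> ereal t < edge_hi C e \<Longrightarrow>
         ord_at C f (Interior e t) \<noteq> 0 \<Longrightarrow> ereal t \<in> B e"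
    by metis
  have "{x \<in> points C. ord_at C f x \<noteq> 0} \<subseteq>
      Vertex ` verts C \<union> (\<Union>e\<in>edges C. (\<lambda>s. Interior e (real_of_ereal s)) ` B e)"
  proof
    fix x assume "x \<in> {x \<in> points C. ord_at C f x \<noteq> 0}"
    then have x: "x \<in> points C" "ord_at C f x \<noteq> 0" by auto
    show "x \<in> Vertex ` verts C \<union> (\<Union>e\<in>edges C. (\<lambda>s. Interior e (real_of_ereal s)) ` B e)"
    proof (cases x)
      case (Vertex v)
      then show ?thesis using x by (auto simp: points_def)
    next
      case (Interior e t)
      then have e: "e \<in> edges C" and "ereal t \<in> B e" using x B(2) by (auto simp: points_def)
      then have "x \<in> (\<lambda>s. Interior e (real_of_ereal s)) ` B e"
        using Interior by (intro image_eqI[of _ _ "ereal t"]) auto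
      then show ?thesis using e by blast
    qed
  qed
  then show ?thesis
    by (rule finite_subset) (use C B(1) in \<open>auto simp: compact_tropical_curve_def\<close>)
qed

end

(* Subdivide every edge so that f and g are both affine on each segment, and group the germs of the
   subdivision by segment instead of by point.  A segment of length l on which f and g have slopes
   m and m' contributes -m * m' * l to either side; on an unbounded segment finiteness forces
   m = m' = 0. *)

theory Submission
  imports Defs
begin

section \<open>Affine functions on segments of the extended real line\<close>

text \<open>If \<open>m\<close> were nonzero, \<open>x\<close> could be recovered as
  \<open>(m * x + c - c) / m\<close> and would converge along \<open>F\<close>, although it tends to
  infinity there. Taken with \<open>at_bot\<close> and \<open>at_top\<close>, this is how a finite
  value at a point at infinity kills the slope.\<close>

lemma affine_limit_at_infinity:
  fixes m c L :: real and F :: "real filter"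
  assumes "((\<lambda>x. m * x + c) \<longlongrightarrow> L) F" "filterlim (\<lambda>x. x) at_infinity F" "F \<noteq> bot"
  shows "m = 0"
proof (rule ccontr)
  assume m: "m \<noteq> 0"
  have "((\<lambda>x. (m * x + c - c) / m) \<longlongrightarrow> (L - c) / m) F"
    by (intro tendsto_intros assms m)
  then have "((\<lambda>x. x) \<longlongrightarrow> (L - c) / m) F"
    using m by simp
  with assms(2,3) show False
    using not_tendsto_and_filterlim_at_infinity by blast
qed

text \<open>The affine formula is given on the open segment only, and continuity carries it to the
  end. At -\<infinity> the term \<open>real_of_ereal a\<close> is merely the default 0, so there the
  conclusion is stated as vanishing of the slope instead.\<close>

lemma continuous_affine_lower_end:
  fixes a b :: ereal and h :: "ereal \<Rightarrow> real"
  assumes ab: "a < b" and cont: "continuous_on {a..b} h"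
    and h: "\<And>s. a < s \<Longrightarrow> s < b \<Longrightarrow> h s = m * real_of_ereal s + c"
  shows "if a = -\<infinity> then m = 0 else h a = m * real_of_ereal a + c"
proof -
  have "(h \<longlongrightarrow> h a) (at_right a)"
    using continuous_on_Icc_at_rightD[OF cont ab] .
  moreover have ev: "\<forall>\<^sub>F s in at_right a. h s = m * real_of_ereal s + c"
    unfolding eventually_at_right[OF ab] using ab h by blast
  ultimately have lim: "((\<lambda>s. m * real_of_ereal s + c) \<longlongrightarrow> h a) (at_right a)"
    using tendsto_cong by force
  show ?thesis
  proof (cases a)
    case (real r)
    have "((\<lambda>x. m * x + c) \<longlongrightarrow> m * r + c) (at_right r)"
      by (intro tendsto_intros)
    moreover have "((\<lambda>x. m * x + c) \<longlongrightarrow> h a) (at_right r)"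
      using lim by (simp add: real at_right_ereal filterlim_filtermap)
    ultimately have "h a = m * r + c"
      using tendsto_unique trivial_limit_at_right_real by blast
    then show ?thesis using real by simp
  next
    case MInf
    \<comment> \<open>In \<open>ereal\<close> the filter \<open>at_right\<close> at -\<infinity> is
      the image of \<open>at_bot\<close> under \<open>ereal\<close>, so the limit becomes one over
      the reals.\<close>
    have "((\<lambda>x. m * x + c) \<longlongrightarrow> h a) at_bot"
      using lim by (simp add: MInf at_right_MInf filterlim_filtermap)
    then have "m = 0"
      by (rule affine_limit_at_infinity)
        (auto intro: filterlim_mono[OF filterlim_ident at_bot_le_at_infinity order_refl])
    then show ?thesis using MInf by simp
  qed (use ab in auto)
qed

lemma continuous_affine_upper_end:
  fixes a b :: ereal and h :: "ereal \<Rightarrow> real"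
  assumes ab: "a < b" and cont: "continuous_on {a..b} h"
    and h: "\<And>s. a < s \<Longrightarrow> s < b \<Longrightarrow> h s = m * real_of_ereal s + c"
  shows "if b = \<infinity> then m = 0 else h b = m * real_of_ereal b + c"
proof -
  have "(h \<longlongrightarrow> h b) (at_left b)"
    using continuous_on_Icc_at_leftD[OF cont ab] .
  moreover have ev: "\<forall>\<^sub>F s in at_left b. h s = m * real_of_ereal s + c"
    unfolding eventually_at_left[OF ab] using ab h by blast
  ultimately have lim: "((\<lambda>s. m * real_of_ereal s + c) \<longlongrightarrow> h b) (at_left b)"
    using tendsto_cong by force
  show ?thesis
  proof (cases b)
    case (real r)
    have "((\<lambda>x. m * x + c) \<longlongrightarrow> m * r + c) (at_left r)"
      by (intro tendsto_intros)
    moreover have "((\<lambda>x. m * x + c) \<longlongrightarrow> h b) (at_left r)"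
      using lim by (simp add: real at_left_ereal filterlim_filtermap)
    ultimately have "h b = m * r + c"
      using tendsto_unique trivial_limit_at_left_real by blast
    then show ?thesis using real by simp
  next
    case PInf
    have "((\<lambda>x. m * x + c) \<longlongrightarrow> h b) at_top"
      using lim by (simp add: PInf at_left_PInf filterlim_filtermap)
    then have "m = 0"
      by (rule affine_limit_at_infinity)
        (auto intro: filterlim_mono[OF filterlim_ident at_top_le_at_infinity order_refl])
    then show ?thesis using PInf by simp
  qed (use ab in auto)
qed

text \<open>Between finite ends both sides equal \<open>m * m' * (a - b)\<close>, since the
  constants cancel in the differences. If an end is infinite, \<open>m\<close> and \<open>m'\<close>
  are both 0 and so are both sides.\<close>

lemma affine_reciprocity:
  fixes a b :: ereal and h k :: "ereal \<Rightarrow> real"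
  assumes "a < b" and "continuous_on {a..b} h" and "continuous_on {a..b} k"
    and "\<And>s. a < s \<Longrightarrow> s < b \<Longrightarrow> h s = m * real_of_ereal s + c"
    and "\<And>s. a < s \<Longrightarrow> s < b \<Longrightarrow> k s = m' * real_of_ereal s + c'"
  shows "(h a - h b) * m' = (k a - k b) * m"
  using continuous_affine_lower_end[OF assms(1,2,4)] continuous_affine_lower_end[OF assms(1,3,5)]
    continuous_affine_upper_end[OF assms(1,2,4)] continuous_affine_upper_end[OF assms(1,3,5)]
  by (auto simp: algebra_simps split: if_splits)

section \<open>Slopes and reciprocity on one segment of an edge\<close>

lemma continuous_on_edge:
  assumes "compact_tropical_curve C" "piecewise_linear C f" "e \<in> edges C"
  shows "continuous_on {edge_lo C e..edge_hi C e} (\<lambda>t. f (edge_map C e t))"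
proof -
  have "continuous_map (top_of_set {edge_lo C e..edge_hi C e}) euclideanreal (f \<circ> edge_map C e)"
    using continuous_map_edge_map[OF assms(1,3)] assms(2)
    by (intro continuous_map_compose) (auto simp: piecewise_linear_def)
  then show ?thesis
    by (simp add: continuous_map_iff_continuous comp_def)
qed

text \<open>Both germs point into the segment; the one at \<open>b\<close> runs against the
  parameter, whence the sign. Infinite ends are covered, because \<open>a < b\<close> alone gives
  \<open>a < \<infinity>\<close> and \<open>- \<infinity> < b\<close>.\<close>

lemma outgoing_slope_segment:
  assumes "a < b" and f: "\<And>s. a < s \<Longrightarrow> s < b \<Longrightarrow> f (edge_map C e s) = m * real_of_ereal s + c"
  shows "outgoing_slope C f (e, a, Increasing) = m"
    and "outgoing_slope C f (e, b, Decreasing) = - m"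
proof -
  show "outgoing_slope C f (e, a, Increasing) = m"
  proof (rule outgoing_slope_IncreasingI)
    show "\<forall>\<^sub>F s in at_right a. f (edge_map C e s) = m * real_of_ereal s + c"
      unfolding eventually_at_right[OF assms(1)] using assms by blast
  qed (use assms(1) in \<open>cases a; auto\<close>)
  show "outgoing_slope C f (e, b, Decreasing) = - m"
  proof (rule outgoing_slope_DecreasingI)
    show "\<forall>\<^sub>F s in at_left b. f (edge_map C e s) = - (- m) * real_of_ereal s + c"
      unfolding eventually_at_left[OF assms(1)] using assms by auto
  qed (use assms(1) in \<open>cases b; auto\<close>)
qed

text \<open>With slopes \<open>m\<close> and \<open>m'\<close> of \<open>f\<close> and
  \<open>g\<close>, the left side is the difference of the end values of \<open>f\<close> times
  \<open>m'\<close>, and the right side that of \<open>g\<close> times \<open>m\<close>, so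
  \<open>affine_reciprocity\<close> applies.\<close>

lemma segment_reciprocity:
  assumes C: "compact_tropical_curve C" "piecewise_linear C f" "piecewise_linear C g" "e \<in> edges C"
    and ab: "edge_lo C e \<le> a" "a < b" "b \<le> edge_hi C e"
    and f: "\<exists>m c. \<forall>s. a < s \<and> s < b \<longrightarrow> f (edge_map C e s) = m * real_of_ereal s + c"
    and g: "\<exists>m c. \<forall>s. a < s \<and> s < b \<longrightarrow> g (edge_map C e s) = m * real_of_ereal s + c"
  shows "f (edge_map C e a) * outgoing_slope C g (e, a, Increasing) +
      f (edge_map C e b) * outgoing_slope C g (e, b, Decreasing) =
    g (edge_map C e a) * outgoing_slope C f (e, a, Increasing) +
      g (edge_map C e b) * outgoing_slope C f (e, b, Decreasing)"
proof -
  obtain m c where m: "\<And>s. a < s \<Longrightarrow> s < b \<Longrightarrow> f (edge_map C e s) = m * real_of_ereal s + c"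
    using f by blast
  obtain m' c' where m': "\<And>s. a < s \<Longrightarrow> s < b \<Longrightarrow> g (edge_map C e s) = m' * real_of_ereal s + c'"
    using g by blast
  have sub: "{a..b} \<subseteq> {edge_lo C e..edge_hi C e}" using ab by auto
  have "(f (edge_map C e a) - f (edge_map C e b)) * m' = (g (edge_map C e a) - g (edge_map C e b)) * m"
    by (rule affine_reciprocity[OF ab(2) _ _ m m'])
      (auto intro: continuous_on_subset[OF continuous_on_edge sub] C)
  then show ?thesis
    \<comment> \<open>The defining equations are removed so that the slopes are not unfolded to
      \<open>THE\<close> before their computed values can be substituted.\<close>
    by (simp add: outgoing_slope_segment[OF ab(2) m] outgoing_slope_segment[OF ab(2) m']
        algebra_simps del: outgoing_slope.simps)
qed

section \<open>Subdivision of an edge at finitely many parameters\<close>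

lemma finite_set_enumeration:
  fixes B :: "'a::linorder set"
  assumes "finite B" "lo \<in> B" "hi \<in> B" "\<And>t. t \<in> B \<Longrightarrow> lo \<le> t \<and> t \<le> hi"
  obtains n :: nat and \<sigma> where "bij_betw \<sigma> {..n} B" "strict_mono_on {..n} \<sigma>" "\<sigma> 0 = lo" "\<sigma> n = hi"
proof -
  define xs where "xs = sorted_list_of_set B"
  define n where "n = length xs - 1"
  have xs: "set xs = B" "sorted_wrt (<) xs" "distinct xs"
    using assms(1) by (auto simp: xs_def)
  \<comment> \<open>As \<open>lo\<close> lies in \<open>B\<close>, the list is nonempty and the
    truncated subtraction in \<open>n\<close> is exact; \<open>n\<close> counts the gaps between
    consecutive elements.\<close>
  have ne: "{..n} = {..<length xs}"
    using xs(1) assms(2) by (cases xs) (auto simp: n_def)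
  have bij: "bij_betw (nth xs) {..n} B"
    using xs ne by (intro bij_betw_nth) auto
  have mono: "strict_mono_on {..n} (nth xs)"
    using xs(2) unfolding ne by (auto simp: strict_mono_on_def sorted_wrt_iff_nth_less)
  have le: "xs ! i \<le> xs ! j" if "i \<le> j" "j \<le> n" for i j
    using strict_mono_on_leD[OF mono] that by simp
  obtain i where "i \<le> n" "xs ! i = lo"
    using bij assms(2) by (auto simp: bij_betw_def)
  then have "xs ! 0 = lo"
    using le[of 0 i] assms(4)[of "xs ! 0"] bij by (auto simp: bij_betw_def)
  moreover obtain j where "j \<le> n" "xs ! j = hi"
    using bij assms(3) by (auto simp: bij_betw_def)
  then have "xs ! n = hi"
    using le[of j n] assms(4)[of "xs ! n"] bij by (auto simp: bij_betw_def)
  ultimately show thesis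
    using that bij mono by blast
qed

text \<open>The share of the edge \<open>e\<close> in the sum of \<open>f x * ord_at C g x\<close>,
  for base points with parameter in \<open>B\<close>. An end of the interval is left out where the
  germ would leave the edge.\<close>

definition edge_sum ::
    "('v, 'e) metric_graph \<Rightarrow> 'e \<Rightarrow> ereal set \<Rightarrow> (('v, 'e) point \<Rightarrow> real) \<Rightarrow> (('v, 'e) point \<Rightarrow> real) \<Rightarrow> real"
  where "edge_sum C e B f g =
    (\<Sum>t\<in>B - {edge_hi C e}. f (edge_map C e t) * outgoing_slope C g (e, t, Increasing)) +
    (\<Sum>t\<in>B - {edge_lo C e}. f (edge_map C e t) * outgoing_slope C g (e, t, Decreasing))"

text \<open>Increasing germs start at indices 0 to \<open>n - 1\<close>, decreasing ones at 1 to
  \<open>n\<close>. Shifting the latter by \<open>Suc\<close> pairs the two germs that point into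
  the same segment.\<close>

lemma edge_sum_enumeration:
  assumes bij: "bij_betw \<sigma> {..n} B" and ends: "\<sigma> 0 = edge_lo C e" "\<sigma> n = edge_hi C e"
  shows "edge_sum C e B f g = (\<Sum>i<n.
    f (edge_map C e (\<sigma> i)) * outgoing_slope C g (e, \<sigma> i, Increasing) +
    f (edge_map C e (\<sigma> (Suc i))) * outgoing_slope C g (e, \<sigma> (Suc i), Decreasing))"
proof -
  have inj: "inj_on \<sigma> {..n}" and im: "\<sigma> ` {..n} = B" using bij by (auto simp: bij_betw_def)
  have "\<sigma> ` ({..n} - {n}) = B - {edge_hi C e}"
    by (subst inj_on_image_set_diff[OF inj]) (auto simp: im ends)
  moreover have "{..n} - {n} = {..<n}" by auto
  ultimately have hi: "\<sigma> ` {..<n} = B - {edge_hi C e}" by simp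
  have "\<sigma> ` ({..n} - {0}) = B - {edge_lo C e}"
    by (subst inj_on_image_set_diff[OF inj]) (auto simp: im ends)
  moreover have "{..n} - {0} = Suc ` {..<n}"
    by (auto simp: image_iff) (metis Suc_le_lessD not0_implies_Suc lessThan_iff)
  ultimately have lo: "(\<sigma> \<circ> Suc) ` {..<n} = B - {edge_lo C e}" by (simp add: image_comp)
  have "inj_on \<sigma> {..<n}" "inj_on (\<sigma> \<circ> Suc) {..<n}"
    by (auto intro!: comp_inj_on inj_on_subset[OF inj])
  then show ?thesis
    unfolding edge_sum_def hi[symmetric] lo[symmetric]
    by (subst (1 2) sum.reindex) (simp_all add: sum.distrib)
qed

text \<open>The gap of \<tau> that contains \<open>a\<close> must reach at least to
  \<open>b\<close>, since its upper end lies beyond \<open>a\<close> and hence not before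
  \<open>b\<close>.\<close>

lemma affine_between_breakpoints:
  fixes \<tau> :: "nat \<Rightarrow> 'a::linorder"
  assumes \<tau>: "\<forall>i<n. \<exists>m c. \<forall>s. \<tau> i < s \<and> s < \<tau> (Suc i) \<longrightarrow> h s = m * r s + c"
    and "\<tau> 0 \<le> a" "a < b" "b \<le> \<tau> n" and "\<And>i. i \<le> n \<Longrightarrow> \<tau> i \<le> a \<or> b \<le> \<tau> i"
  shows "\<exists>m c. \<forall>s. a < s \<and> s < b \<longrightarrow> h s = m * r s + (c::real)"
proof -
  obtain i where i: "i < n" "\<tau> i \<le> a" "a < \<tau> (Suc i)"
    using exists_breakpoint_gap[OF assms(2) less_le_trans[OF assms(3,4)]] by blast
  then have "b \<le> \<tau> (Suc i)" using assms(5)[of "Suc i"] by auto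
  with \<tau> i show ?thesis by (meson le_less_trans less_le_trans)
qed

text \<open>Phrased through open subintervals that avoid \<open>B\<close>, the notion is monotone in
  \<open>B\<close>, so \<open>f\<close> and \<open>g\<close> can share one subdivision and further
  points can be added freely.\<close>

definition breakpoints :: "('v, 'e) metric_graph \<Rightarrow> (('v, 'e) point \<Rightarrow> real) \<Rightarrow> 'e \<Rightarrow> ereal set \<Rightarrow> bool" where
  "breakpoints C f e B \<longleftrightarrow> (\<forall>a b. edge_lo C e \<le> a \<and> a < b \<and> b \<le> edge_hi C e \<and> {a<..<b} \<inter> B = {} \<longrightarrow>
    (\<exists>m c. \<forall>s. a < s \<and> s < b \<longrightarrow> f (edge_map C e s) = m * real_of_ereal s + c))"

lemma breakpoints_mono: "breakpoints C f e A \<Longrightarrow> A \<subseteq> B \<Longrightarrow> breakpoints C f e B"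
  unfolding breakpoints_def by blast

lemma finite_breakpoints_exist:
  assumes "piecewise_linear C f" "e \<in> edges C"
  obtains B where "finite B" "breakpoints C f e B"
proof -
  obtain n \<tau> where \<tau>: "\<tau> (0::nat) = edge_lo C e" "\<tau> n = edge_hi C e"
      "\<forall>i<n. \<exists>m c. \<forall>s. \<tau> i < s \<and> s < \<tau> (Suc i) \<longrightarrow>
              f (edge_map C e s) = m * real_of_ereal s + c"
    by (rule piecewise_linearE[OF assms])
  have "breakpoints C f e (\<tau> ` {..n})"
    unfolding breakpoints_def
  proof (intro allI impI, elim conjE)
    fix a b assume ab: "edge_lo C e \<le> a" "a < b" "b \<le> edge_hi C e" "{a<..<b} \<inter> \<tau> ` {..n} = {}"
    show "\<exists>m c. \<forall>s. a < s \<and> s < b \<longrightarrow> f (edge_map C e s) = m * real_of_ereal s + c"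
    proof (rule affine_between_breakpoints[OF \<tau>(3)])
      show "\<tau> i \<le> a \<or> b \<le> \<tau> i" if "i \<le> n" for i
      proof -
        have "\<tau> i \<notin> {a<..<b}" using ab(4) that by blast
        then show ?thesis by auto
      qed
    qed (use ab \<tau> in auto)
  qed
  then show thesis using that by blast
qed

text \<open>Consecutive elements of \<open>B\<close> bound segments free of breakpoints, so the two
  sums agree term by term by \<open>segment_reciprocity\<close>.\<close>

lemma edge_reciprocity:
  assumes C: "compact_tropical_curve C" "piecewise_linear C f" "piecewise_linear C g" "e \<in> edges C"
    and B: "finite B" "edge_lo C e \<in> B" "edge_hi C e \<in> B" "B \<subseteq> {edge_lo C e..edge_hi C e}"
      "breakpoints C f e B" "breakpoints C g e B"
  shows "edge_sum C e B f g = edge_sum C e B g f"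
proof -
  obtain n :: nat and \<sigma> where \<sigma>: "bij_betw \<sigma> {..n} B" "strict_mono_on {..n} \<sigma>"
      "\<sigma> 0 = edge_lo C e" "\<sigma> n = edge_hi C e"
    by (rule finite_set_enumeration[OF B(1-3)]) (use B(4) in auto)
  show ?thesis
    unfolding edge_sum_enumeration[where \<sigma>=\<sigma>, OF \<sigma>(1,3,4)]
  proof (rule sum.cong[OF refl])
    fix i assume "i \<in> {..<n}"
    then have i: "i < n" by simp
    have in_B: "\<sigma> j \<in> B" if "j \<le> n" for j using \<sigma>(1) that by (auto simp: bij_betw_def)
    have *: "edge_lo C e \<le> \<sigma> i" "\<sigma> i < \<sigma> (Suc i)" "\<sigma> (Suc i) \<le> edge_hi C e"
      using B(4) in_B[of i] in_B[of "Suc i"] i \<sigma>(2) by (auto simp: strict_mono_on_def)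
    \<comment> \<open>By strict monotonicity such a \<open>j\<close> would lie strictly between
      \<open>i\<close> and \<open>Suc i\<close>.\<close>
    have "\<sigma> j \<notin> {\<sigma> i<..<\<sigma> (Suc i)}" if "j \<le> n" for j
      using i that strict_mono_on_less[OF \<sigma>(2)] by simp
    then have "{\<sigma> i<..<\<sigma> (Suc i)} \<inter> B = {}"
      using \<sigma>(1) unfolding bij_betw_def by blast
    with * B(5,6) show "f (edge_map C e (\<sigma> i)) * outgoing_slope C g (e, \<sigma> i, Increasing) +
        f (edge_map C e (\<sigma> (Suc i))) * outgoing_slope C g (e, \<sigma> (Suc i), Decreasing) =
      g (edge_map C e (\<sigma> i)) * outgoing_slope C f (e, \<sigma> i, Increasing) +
        g (edge_map C e (\<sigma> (Suc i))) * outgoing_slope C f (e, \<sigma> (Suc i), Decreasing)"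
      by (intro segment_reciprocity[OF C *]) (auto simp: breakpoints_def)
  qed
qed

section \<open>Regrouping the germs of the curve by edge\<close>

text \<open>Parameters are collected instead of points, so a loop whose vertex lies in
  \<open>S\<close> contributes both of its ends.\<close>

definition edge_preimage ::
    "('v, 'e) metric_graph \<Rightarrow> ('v, 'e) point set \<Rightarrow> 'e \<Rightarrow> ereal set" where
  "edge_preimage C S e = {t \<in> {edge_lo C e..edge_hi C e}. edge_map C e t \<in> S}"

text \<open>Only the two ends of an edge can be glued together; away from them
  \<open>edge_map\<close> is injective, so the remaining parameters are no more numerous than
  \<open>S\<close>.\<close>

lemma finite_edge_preimage:
  assumes "finite S"
  shows "finite (edge_preimage C S e)"
proof -
  have "inj_on (edge_map C e) (edge_preimage C S e - {edge_lo C e, edge_hi C e})"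
  proof (rule inj_onI)
    fix s t
    assume *: "s \<in> edge_preimage C S e - {edge_lo C e, edge_hi C e}"
        "t \<in> edge_preimage C S e - {edge_lo C e, edge_hi C e}" "edge_map C e s = edge_map C e t"
    then have "real_of_ereal s = real_of_ereal t"
      by (auto simp: edge_map_def)
    \<comment> \<open>Strictly inside the interval parameters are finite, where
      \<open>real_of_ereal\<close> is injective.\<close>
    with * show "s = t"
      by (cases s; cases t) (auto simp: edge_preimage_def)
  qed
  moreover have "edge_map C e ` (edge_preimage C S e - {edge_lo C e, edge_hi C e}) \<subseteq> S"
    by (auto simp: edge_preimage_def)
  ultimately have "finite (edge_preimage C S e - {edge_lo C e, edge_hi C e})"
    using assms by (metis finite_imageD finite_subset)
  then show ?thesis by simp
qed

text \<open>Double counting: the germs based at points of \<open>S\<close> are listed once by base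
  point and once by edge, direction and parameter.\<close>

lemma sum_ord_eq_sum_edges:
  fixes C :: "('v, 'e) metric_graph"
  assumes C: "compact_tropical_curve C" and S: "finite S"
  shows "(\<Sum>x\<in>S. f x * ord_at C g x) = (\<Sum>e\<in>edges C. edge_sum C e (edge_preimage C S e) f g)"
proof -
  \<comment> \<open>The base point is read off from the germ itself, so the summand does not depend
    on the grouping.\<close>
  define P where "P = (\<lambda>(e, t, d). f (edge_map C e t) * outgoing_slope C g (e, t, d))"
  define I where "I e = (\<lambda>t. (e, t, Increasing)) ` (edge_preimage C S e - {edge_hi C e})" for e
  define D where "D e = (\<lambda>t. (e, t, Decreasing)) ` (edge_preimage C S e - {edge_lo C e})" for e
  note fin = finite_edge_preimage[OF S]
  have "(\<Sum>x\<in>S. f x * ord_at C g x) = (\<Sum>x\<in>S. \<Sum>\<gamma>\<in>germs C x. P \<gamma>)"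
    unfolding ord_at_def sum_distrib_left P_def
    by (intro sum.cong refl) (auto simp: germs_def)
  also have "\<dots> = sum P (\<Union>x\<in>S. germs C x)"
    by (rule sum.UNION_disjoint[symmetric])
      (use S finite_germs[OF C] in \<open>auto simp: germs_def\<close>)
  \<comment> \<open>The side condition on the direction in \<open>germs\<close> is what removes
    \<open>edge_hi C e\<close> from \<open>I e\<close> and \<open>edge_lo C e\<close> from
    \<open>D e\<close>.\<close>
  also have "(\<Union>x\<in>S. germs C x) = (\<Union>e\<in>edges C. I e \<union> D e)"
  proof (rule set_eqI)
    fix \<gamma> :: "'e \<times> ereal \<times> direction"
    obtain e t d where "\<gamma> = (e, t, d)" by (cases \<gamma>)
    then show "\<gamma> \<in> (\<Union>x\<in>S. germs C x) \<longleftrightarrow> \<gamma> \<in> (\<Union>e\<in>edges C. I e \<union> D e)"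
      by (cases d) (auto simp: germs_def edge_preimage_def I_def D_def)
  qed
  also have "sum P \<dots> = (\<Sum>e\<in>edges C. sum P (I e \<union> D e))"
    by (rule sum.UNION_disjoint)
      (use C fin in \<open>auto simp: compact_tropical_curve_def I_def D_def\<close>)
  also have "\<dots> = (\<Sum>e\<in>edges C. sum P (I e) + sum P (D e))"
    by (intro sum.cong refl sum.union_disjoint) (use fin in \<open>auto simp: I_def D_def\<close>)
  also have "\<dots> = (\<Sum>e\<in>edges C. edge_sum C e (edge_preimage C S e) f g)"
    unfolding edge_sum_def I_def D_def
    by (intro sum.cong refl arg_cong2[where f="(+)"])
      (subst sum.reindex; auto simp: inj_on_def P_def)+
  finally show ?thesis .
qed

theorem theorem2p2:
  fixes C :: "('v, 'e) metric_graph" and f g :: "('v, 'e) point \<Rightarrow> real"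
  assumes "compact_tropical_curve C"
    and "piecewise_linear C f" and "integer_slopes C f"
    and "piecewise_linear C g" and "integer_slopes C g"
  shows "(\<Sum>x\<in>{x \<in> points C. ord_at C g x \<noteq> 0}. f x * ord_at C g x) =
         (\<Sum>x\<in>{x \<in> points C. ord_at C f x \<noteq> 0}. g x * ord_at C f x)"
proof -
  note C = assms(1) and f = assms(2) and g = assms(4)
  let ?I = "\<lambda>e. {edge_lo C e..edge_hi C e}"
  have "\<forall>e\<in>edges C. \<exists>B. finite B \<and> breakpoints C f e B \<and> breakpoints C g e B"
    by (metis f g finite_breakpoints_exist breakpoints_mono finite_UnI Un_upper1 Un_upper2)
  then obtain B where B: "\<And>e. e \<in> edges C \<Longrightarrow>
      finite (B e) \<and> breakpoints C f e (B e) \<and> breakpoints C g e (B e)"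
    by metis
  \<comment> \<open>One finite set serves both sums: it contains the two supports, the vertices, so
    that each edge is subdivided at its ends, and the breakpoints of both functions.\<close>
  define S where "S = {x \<in> points C. ord_at C f x \<noteq> 0} \<union> {x \<in> points C. ord_at C g x \<noteq> 0} \<union>
    Vertex ` verts C \<union> (\<Union>e\<in>edges C. edge_map C e ` (B e \<inter> ?I e))"
  have S: "finite S"
    using C B finite_ord_support[OF C f] finite_ord_support[OF C g]
    by (auto simp: S_def compact_tropical_curve_def)
  have "edge_map C e ` (B e \<inter> ?I e) \<subseteq> points C" if "e \<in> edges C" for e
    using edge_map_in_points[OF C that] by blast
  moreover have "Vertex ` verts C \<subseteq> points C" by (auto simp: points_def)
  \<comment> \<open>For points of the curve, lying outside the support means order zero, so passing
    from a support to \<open>S\<close> only adds zero terms.\<close>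
  ultimately have "S \<subseteq> points C" unfolding S_def by blast
  then have support_sum: "(\<Sum>x\<in>{x \<in> points C. ord_at C k x \<noteq> 0}. h x * ord_at C k x) =
      (\<Sum>x\<in>S. h x * ord_at C k x)" if "{x \<in> points C. ord_at C k x \<noteq> 0} \<subseteq> S" for h k
    using that by (intro sum.mono_neutral_left S) auto
  have supp: "{x \<in> points C. ord_at C f x \<noteq> 0} \<subseteq> S" "{x \<in> points C. ord_at C g x \<noteq> 0} \<subseteq> S"
    unfolding S_def by blast+
  have "edge_sum C e (edge_preimage C S e) f g = edge_sum C e (edge_preimage C S e) g f"
    if e: "e \<in> edges C" for e
  proof (rule edge_reciprocity[OF C f g e finite_edge_preimage[OF S]])
    have lohi: "edge_lo C e < edge_hi C e" "tail C e \<in> verts C" "head C e \<in> verts C"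
      using C e by (auto simp: compact_tropical_curve_def)
    then show "edge_lo C e \<in> edge_preimage C S e" "edge_hi C e \<in> edge_preimage C S e"
      by (auto simp: edge_preimage_def S_def edge_map_def)
    show "edge_preimage C S e \<subseteq> ?I e" by (auto simp: edge_preimage_def)
    have "B e \<inter> ?I e \<subseteq> edge_preimage C S e"
      using e by (auto simp: edge_preimage_def S_def)
    \<comment> \<open>\<open>B e\<close> may stick out of the parameter interval, but only elements
      inside it can fall between \<open>a\<close> and \<open>b\<close>.\<close>
    moreover have "breakpoints C h e (B e \<inter> ?I e)" if "breakpoints C h e (B e)" for h
      unfolding breakpoints_def
    proof (intro allI impI, elim conjE)
      fix a b assume ab: "edge_lo C e \<le> a" "a < b" "b \<le> edge_hi C e" "{a<..<b} \<inter> (B e \<inter> ?I e) = {}"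
      then have "{a<..<b} \<inter> B e = {}" by force
      with ab that show "\<exists>m c. \<forall>s. a < s \<and> s < b \<longrightarrow> h (edge_map C e s) = m * real_of_ereal s + c"
        unfolding breakpoints_def by blast
    qed
    ultimately show "breakpoints C f e (edge_preimage C S e)" "breakpoints C g e (edge_preimage C S e)"
      using B[OF e] by (blast intro: breakpoints_mono)+
  qed
  then show ?thesis
    unfolding support_sum[OF supp(1)] support_sum[OF supp(2)] sum_ord_eq_sum_edges[OF C S] by simp
qed

end
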